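(* Let $n\ge 1$ and let $A$ be a real $n\times n$ matrix. Then the following hold: (a) If $A$ is a diagonal matrix whose diagonal entries are each either $0$ or $\frac{1}{2}$, then the Lyapunov operator $L_A$ is range monotone. (b) If $A$ satisfies $A^2=A$ or $A^2=-A$, then the Stein operator $S_A$ is range monotone.
   Context: $\mathcal{S}^n$ denotes the real vector space of real symmetric $n\times n$ matrices, and $X\succeq 0$ means that the symmetric matrix $X$ is positive semidefinite. For a real $n\times n$ matrix $A$, the Lyapunov operator $L_A:\mathcal{S}^n\to\mathcal{S}^n$ is $L_A(X)=AX+XA^T$, and the Stein operator $S_A:\mathcal{S}^n\to\mathcal{S}^n$ is $S_A(X)=X-AXA^T$. For a linear operator $T:\mathcal{S}^n\to\mathcal{S}^n$, $R(T)$ denotes its range. $T$ is called range monotone if for every $X\in R(T)$, $T(X)\succeq 0$ implies $X\succeq 0$. *)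

theory Defs
  imports "HOL-Analysis.Analysis"
begin

definition sym_mats :: "(real^'n^'n) set" where
  "sym_mats = {X. transpose X = X}"

definition psd :: "real^'n^'n \<Rightarrow> bool" where
  "psd X \<longleftrightarrow> X \<in> sym_mats \<and> (\<forall>v. 0 \<le> v \<bullet> (X *v v))"

definition lyapunov_op :: "real^'n^'n \<Rightarrow> real^'n^'n \<Rightarrow> real^'n^'n" where
  "lyapunov_op A X = A ** X + X ** transpose A"

definition stein_op :: "real^'n^'n \<Rightarrow> real^'n^'n \<Rightarrow> real^'n^'n" where
  "stein_op A X = X - A ** X ** transpose A"

lemma subspace_sym_mats: "subspace sym_mats"
  by (auto simp: subspace_def sym_mats_def transpose_def vec_eq_iff)

lemma lyapunov_op_sym_mats:
  fixes A :: "real^'n^'n"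
  shows "lyapunov_op A \<in> sym_mats \<rightarrow> sym_mats"
proof
  fix X :: "real^'n^'n" assume "X \<in> sym_mats"
  moreover have "transpose (M + N) = transpose M + transpose N" for M N :: "real^'n^'n"
    by (simp add: transpose_def vec_eq_iff)
  ultimately show "lyapunov_op A X \<in> sym_mats"
    by (simp add: sym_mats_def lyapunov_op_def matrix_transpose_mul add.commute)
qed

lemma stein_op_sym_mats:
  fixes A :: "real^'n^'n"
  shows "stein_op A \<in> sym_mats \<rightarrow> sym_mats"
proof
  fix X :: "real^'n^'n" assume "X \<in> sym_mats"
  moreover have "transpose (M - N) = transpose M - transpose N" for M N :: "real^'n^'n"
    by (simp add: transpose_def vec_eq_iff)
  ultimately show "stein_op A X \<in> sym_mats"
    by (simp add: sym_mats_def stein_op_def matrix_transpose_mul matrix_mul_assoc)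
qed

lemma linear_lyapunov_op: "linear (lyapunov_op A)"
  by (rule linearI)
    (simp_all add: lyapunov_op_def vec_eq_iff matrix_matrix_mult_def sum.distrib sum_distrib_left
      algebra_simps)

lemma linear_stein_op: "linear (stein_op A)"
  by (rule linearI)
    (simp_all add: stein_op_def vec_eq_iff matrix_matrix_mult_def sum.distrib sum_distrib_left
      sum_distrib_right algebra_simps)

text \<open>
  An operator on symmetric matrices is represented by a function on all square matrices that maps
  \<^const>\<open>sym_mats\<close> into itself; its range is the image of \<^const>\<open>sym_mats\<close>, not of all matrices.
\<close>

definition range_monotone :: "(real^'n^'n \<Rightarrow> real^'n^'n) \<Rightarrow> bool" where
  "range_monotone T \<longleftrightarrow> (\<forall>X \<in> T ` sym_mats. psd (T X) \<longrightarrow> psd X)"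

end

theory Submission
  imports Defs
begin

text \<open>
  In both cases the operator fixes every \<open>X\<close> in its range whose image is positive semidefinite.
  If \<open>A\<^sup>2 = \<plusminus>A\<close> then \<open>A X A\<^sup>T\<close> vanishes on the range of the Stein operator.
  If \<open>A\<close> is diagonal then the Lyapunov operator multiplies the entry \<open>(i, j)\<close> by
  \<open>a\<^sub>i + a\<^sub>j\<close>; for \<open>a\<^sub>i \<in> {0, 1/2}\<close> the only entries not multiplied by \<open>1\<close> lie in a row or column
  \<open>k\<close> with \<open>a\<^sub>k = 0\<close>, and these vanish because the image has a zero diagonal entry there.
\<close>

text \<open>With \<open>M $ j $ j = 0\<close> the quadratic form at e_i + t e_j is affine in t with
  slope \<open>2 * M $ i $ j\<close>, so a nonzero slope would make it negative somewhere.\<close>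

lemma psd_diagonal_zero_imp_entry_zero:
  fixes M :: "real^'n^'n"
  assumes "psd M" and "M $ j $ j = 0"
  shows "M $ i $ j = 0"
proof (rule ccontr)
  assume nz: "M $ i $ j \<noteq> 0"
  have entry: "axis k 1 \<bullet> (M *v axis l 1) = M $ k $ l" for k l
    by (simp add: inner_axis' matrix_vector_mult_basis column_def)
  have sym: "M $ j $ i = M $ i $ j"
    using assms(1) by (auto simp: psd_def sym_mats_def transpose_def vec_eq_iff)
  \<comment> \<open>The solution of \<open>M $ i $ i + 2 * t * M $ i $ j = - 1\<close>.\<close>
  define t where "t = - (M $ i $ i + 1) / (2 * M $ i $ j)"
  define v :: "real^'n" where "v = axis i 1 + t *\<^sub>R axis j 1"
  have "v \<bullet> (M *v v) = M $ i $ i + 2 * t * M $ i $ j"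
    by (simp add: v_def matrix_vector_right_distrib matrix_vector_mult_scaleR
        inner_add_left inner_add_right entry assms(2) sym)
  also have "\<dots> = - 1"
    using nz by (simp add: t_def field_simps)
  finally show False
    using assms(1) by (auto simp: psd_def dest: spec[of _ v])
qed

lemma lyapunov_op_diagonal_nth:
  fixes A :: "real^'n^'n"
  assumes "\<And>i j. i \<noteq> j \<Longrightarrow> A $ i $ j = 0"
  shows "lyapunov_op A X $ i $ j = (A $ i $ i + A $ j $ j) * X $ i $ j"
proof -
  have "(\<Sum>k\<in>UNIV. A $ i $ k * X $ k $ j) = A $ i $ i * X $ i $ j"
    using assms by (subst sum.remove[of _ i]) (auto intro!: sum.neutral)
  moreover have "(\<Sum>k\<in>UNIV. X $ i $ k * A $ j $ k) = X $ i $ j * A $ j $ j"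
    using assms by (subst sum.remove[of _ j]) (auto intro!: sum.neutral)
  ultimately show ?thesis
    by (simp add: lyapunov_op_def matrix_matrix_mult_def transpose_def algebra_simps)
qed

lemma range_monotone_lyapunov_op:
  fixes A :: "real^'n^'n"
  assumes off: "\<And>i j. i \<noteq> j \<Longrightarrow> A $ i $ j = 0"
    and diag: "\<And>i. A $ i $ i = 0 \<or> A $ i $ i = 1/2"
  shows "range_monotone (lyapunov_op A)"
  unfolding range_monotone_def
proof (intro ballI impI)
  fix X assume X: "X \<in> lyapunov_op A ` sym_mats" and psd: "psd (lyapunov_op A X)"
  note nth = lyapunov_op_diagonal_nth[OF off]
  have sym: "X $ i $ j = X $ j $ i" for i j
    using X lyapunov_op_sym_mats[of A] by (force simp: sym_mats_def transpose_def vec_eq_iff)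
  have zero: "X $ i $ j = 0" if "A $ j $ j = 0" for i j
  proof (cases "A $ i $ i = 0")
    case True
    \<comment> \<open>The factor is 0, so the image of \<open>X\<close> says nothing about this
      entry; but \<open>X\<close> itself lies in the range, where the entry is 0.\<close>
    then show ?thesis
      using X that by (auto simp: nth)
  next
    case False
    have "lyapunov_op A X $ i $ j = 0"
      using psd by (rule psd_diagonal_zero_imp_entry_zero) (simp add: nth that)
    then show ?thesis
      using False that by (simp add: nth)
  qed
  have "lyapunov_op A X $ i $ j = X $ i $ j" for i j
    using diag[of i] diag[of j] zero[of i j] zero[of j i] sym[of i j] by (auto simp: nth)
  then have "lyapunov_op A X = X"
    by (simp add: vec_eq_iff)
  with psd show "psd X"
    by simp
qed

lemma range_monotone_stein_op:
  fixes A :: "real^'n^'n"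
  assumes "A ** A = A \<or> A ** A = - A"
  shows "range_monotone (stein_op A)"
proof -
  have neg: "- M ** N = - (M ** N)" "M ** - N = - (M ** N)" for M N :: "real^'n^'n"
    by (simp_all add: matrix_matrix_mult_def vec_eq_iff sum_negf)
  have tneg: "transpose (- M) = - transpose M" for M :: "real^'n^'n"
    by (simp add: transpose_def vec_eq_iff)
  have "stein_op A (stein_op A Y) = stein_op A Y" for Y
  proof -
    have "A ** (A ** Y ** transpose A) ** transpose A = A ** A ** Y ** transpose (A ** A)"
      by (simp add: matrix_transpose_mul matrix_mul_assoc)
    \<comment> \<open>If \<open>A ** A = - A\<close>, the signs from the left and right factors
      cancel.\<close>
    also have "\<dots> = A ** Y ** transpose A"
      using assms by (auto simp: neg tneg)
    finally have "stein_op A (A ** Y ** transpose A) = 0"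
      by (simp add: stein_op_def)
    moreover have "stein_op A (stein_op A Y) =
        stein_op A Y - stein_op A (A ** Y ** transpose A)"
      by (metis linear_diff[OF linear_stein_op] stein_op_def)
    ultimately show ?thesis
      by simp
  qed
  then show ?thesis
    by (auto simp: range_monotone_def)
qed

theorem theorem3p10:
  fixes A :: "real^'n^'n"
  shows "((\<forall>i j. i \<noteq> j \<longrightarrow> A $ i $ j = 0) \<and> (\<forall>i. A $ i $ i = 0 \<or> A $ i $ i = 1/2)
           \<longrightarrow> range_monotone (lyapunov_op A))
       \<and> (A ** A = A \<or> A ** A = - A \<longrightarrow> range_monotone (stein_op A))"
  using range_monotone_lyapunov_op[of A] range_monotone_stein_op[of A] by blast

end
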